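(* Let $C=(c_{j,k})_{j,k\geq1}$ be an infinite matrix defining an operator on $\ell^2$. Consider the Dirichlet series $$\varphi(s) = \sum_{j=1}^\infty \sum_{k=1}^\infty c_{j,k} \left(p_{2j-1}p_{2k}\right)^{-s},$$ where $\{p_j\}_{j \geq 1}$ denotes the sequence of prime numbers in increasing order. Then (a) $\|H_\varphi\|_0 = \|C\|$, (b) $\|H_\varphi\| \asymp \|C\|_{S_2} = \|\varphi\|_{\mathscr{H}^2}$, where $\|H_\varphi\|_0$ denotes the norm of $H_\varphi$ acting on $\mathscr{H}^2_0\times\mathscr{H}^2_0$, $\|H_\varphi\|$ denotes the norm of $H_\varphi$ acting on $\mathscr{H}^2\times\mathscr{H}^2$, $\|C\|$ is the operator norm of $C$ on $\ell^2$, and $\|C\|_{S_2}$ denotes the Hilbert--Schmidt norm $\|C\|_{S_2} = \big(\sum_{j=1}^\infty \sum_{k=1}^\infty |c_{j,k}|^2\big)^{1/2}$.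
   Context: $\mathscr{H}^2$ is the Hilbert space of Dirichlet series $f(s)=\sum_{n\ge1}a_nn^{-s}$ with $\|f\|_{\mathscr{H}^2}=(\sum_{n\ge1}|a_n|^2)^{1/2}<\infty$, with inner product $\langle f,g\rangle=\sum_n a_n\overline{b_n}$ (where $b_n$ are the coefficients of $g$), and $\mathscr{H}^2_0$ is its subspace of series with $a_1=f(+\infty)=0$. For a (formal) Dirichlet series $\varphi(s)=\sum_n\overline{\varrho_n}n^{-s}$, the multiplicative Hankel form $H_\varphi$ is the (not necessarily bounded) bilinear form $$H_\varphi(fg)=\langle fg,\varphi\rangle=\sum_{m}\sum_{n}a_mb_n\varrho_{mn},$$ where $f=\sum a_mm^{-s}$ and $g=\sum b_nn^{-s}$, defined initially for Dirichlet polynomials. Its norm on $\mathscr{X}\times\mathscr{X}$, with $\mathscr{X}=\mathscr{H}^2$ or $\mathscr{H}^2_0$, is the least constant $K\in[0,\infty]$ such that $|H_\varphi(fg)|\le K\|f\|_{\mathscr{H}^2}\|g\|_{\mathscr{H}^2}$ for all Dirichlet polynomials $f,g\in\mathscr{X}$. The same symbol $\|\varphi\|_{\mathscr{H}^2}$ denotes the (possibly infinite) $\ell^2$-norm of the coefficients of $\varphi$. The notation $A\asymp B$ means that there are absolute positive constants $c_1,c_2$ with $c_1B\le A\le c_2B$ (in (b), both sides may be $+\infty$). *)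

theory Defs
  imports "HOL-Analysis.Analysis" "HOL-Computational_Algebra.Primes"
begin

(* Sequences and matrices are indexed by the positive integers: a sequence is a function on nat
   whose value at 0 is ignored by every definition below. Norms take values in [0,\<infinity>]. *)

definition ennreal_sqrt :: "ennreal \<Rightarrow> ennreal" where
  "ennreal_sqrt x = (if x = \<infinity> then \<infinity> else ennreal (sqrt (enn2real x)))"

definition l2_norm :: "(nat \<Rightarrow> complex) \<Rightarrow> ennreal" where
  "l2_norm x = ennreal_sqrt (\<Sum>\<^sub>\<infinity>n\<in>{1..}. ennreal ((cmod (x n))\<^sup>2))"

definition l2 :: "(nat \<Rightarrow> complex) set" where
  "l2 = {x. l2_norm x < \<infinity>}"

definition matrix_apply :: "(nat \<Rightarrow> nat \<Rightarrow> complex) \<Rightarrow> (nat \<Rightarrow> complex) \<Rightarrow> nat \<Rightarrow> complex" where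
  "matrix_apply C x j = (\<Sum>\<^sub>\<infinity>k\<in>{1..}. C j k * x k)"

(* Boundedness is not assumed; it is automatic for an everywhere defined matrix operator,
   by the uniform boundedness principle. *)
definition l2_operator :: "(nat \<Rightarrow> nat \<Rightarrow> complex) \<Rightarrow> bool" where
  "l2_operator C \<longleftrightarrow>
     (\<forall>x\<in>l2. (\<forall>j\<ge>1. (\<lambda>k. C j k * x k) summable_on {1..}) \<and> matrix_apply C x \<in> l2)"

definition operator_norm :: "(nat \<Rightarrow> nat \<Rightarrow> complex) \<Rightarrow> ennreal" where
  "operator_norm C = Inf {K. \<forall>x\<in>l2. l2_norm (matrix_apply C x) \<le> K * l2_norm x}"

definition hilbert_schmidt_norm :: "(nat \<Rightarrow> nat \<Rightarrow> complex) \<Rightarrow> ennreal" where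
  "hilbert_schmidt_norm C =
     ennreal_sqrt (\<Sum>\<^sub>\<infinity>j\<in>{1..}. \<Sum>\<^sub>\<infinity>k\<in>{1..}. ennreal ((cmod (C j k))\<^sup>2))"

(* A formal Dirichlet series \<Sum> a n * n powr (-s), n \<ge> 1, is given by its coefficients a. *)
type_synonym dirichlet_series = "nat \<Rightarrow> complex"

definition H2 :: "dirichlet_series set" where
  "H2 = l2"

definition H2_0 :: "dirichlet_series set" where
  "H2_0 = {f \<in> H2. f 1 = 0}"

definition H2_inner :: "dirichlet_series \<Rightarrow> dirichlet_series \<Rightarrow> complex" where
  "H2_inner f g = (\<Sum>\<^sub>\<infinity>n\<in>{1..}. f n * cnj (g n))"

definition dirichlet_mult :: "dirichlet_series \<Rightarrow> dirichlet_series \<Rightarrow> dirichlet_series" where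
  "dirichlet_mult f g n = (\<Sum>d | d dvd n. f d * g (n div d))"

definition dirichlet_polynomial :: "dirichlet_series \<Rightarrow> bool" where
  "dirichlet_polynomial f \<longleftrightarrow> finite {n. f n \<noteq> 0}"

definition hankel_form :: "dirichlet_series \<Rightarrow> dirichlet_series \<Rightarrow> dirichlet_series \<Rightarrow> complex" where
  "hankel_form \<phi> f g = H2_inner (dirichlet_mult f g) \<phi>"

definition hankel_norm :: "dirichlet_series set \<Rightarrow> dirichlet_series \<Rightarrow> ennreal" where
  "hankel_norm X \<phi> = Inf {K. \<forall>f\<in>X. \<forall>g\<in>X. dirichlet_polynomial f \<longrightarrow> dirichlet_polynomial g \<longrightarrow>
     ennreal (cmod (hankel_form \<phi> f g)) \<le> K * l2_norm f * l2_norm g}"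

(* The j-th prime for j \<ge> 1; the library's enumerate counts from 0. *)
definition nth_prime :: "nat \<Rightarrow> nat" where
  "nth_prime j = enumerate {p. prime p} (j - 1)"

(* By unique factorization the index set below has at most one element, since the two primes
   have an odd and an even index respectively. *)
definition matrix_series :: "(nat \<Rightarrow> nat \<Rightarrow> complex) \<Rightarrow> dirichlet_series" where
  "matrix_series C n =
     (\<Sum>(j, k) \<in> {(j, k). 1 \<le> j \<and> 1 \<le> k \<and> nth_prime (2 * j - 1) * nth_prime (2 * k) = n}. C j k)"

end

theory Submission
  imports Defs
begin

text \<open>
  The divisors of \<open>pq\<close> are \<open>1, p, q, pq\<close>, so the coefficient of \<open>fg\<close> at \<open>pq\<close> is
  \<open>f(1) g(pq) + f(p) g(q) + f(q) g(p) + f(pq) g(1)\<close>.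
  If \<open>f(1) = g(1) = 0\<close>, only the two middle terms survive, and the form splits into the bilinear forms
  of the conjugate of \<open>C\<close> on the restrictions of \<open>f\<close> and \<open>g\<close> to primes of odd and of even index;
  since these two sets of primes are disjoint, \<open>av + ub \<le> sqrt (a\<^sup>2 + b\<^sup>2) sqrt (u\<^sup>2 + v\<^sup>2)\<close> loses no
  constant. Conversely, polynomials supported on the primes of odd and of even index, respectively,
  recover every finite section of \<open>C\<close>. On the whole space each of the four terms is controlled by
  Cauchy--Schwarz, which gives the constant 4, and testing with \<open>g = 1\<close> and truncations of the symbol
  gives the lower bound with constant 1.
\<close>

section \<open>Norms of sequences\<close>

lemma ennreal_sqrt_ennreal: "0 \<le> r \<Longrightarrow> ennreal_sqrt (ennreal r) = ennreal (sqrt r)"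
  by (simp add: ennreal_sqrt_def)

lemma ennreal_sqrt_mono: "x \<le> y \<Longrightarrow> ennreal_sqrt x \<le> ennreal_sqrt y"
proof (cases y)
  case (real r)
  assume "x \<le> y"
  with real show ?thesis by (cases x) (auto simp: ennreal_sqrt_def top_unique)
next
  case top
  then show ?thesis by (simp add: ennreal_sqrt_def)
qed

text \<open>In [0,\<infinity>] an infinite sum is the supremum of its finite partial sums. This
  lemma and the next are the two halves of that fact; together they reduce comparisons of infinite
  sums to finite ones.\<close>

lemma sum_le_infsum_ennreal:
  fixes f :: "'a \<Rightarrow> ennreal"
  assumes "finite F" "F \<subseteq> A"
  shows "sum f F \<le> infsum f A"
  unfolding nonneg_infsum_complete[of A f, OF zero_le] using assms by (intro SUP_upper) auto

lemma infsum_le_ennreal: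
  fixes f :: "'a \<Rightarrow> ennreal"
  assumes "\<And>F. finite F \<Longrightarrow> F \<subseteq> A \<Longrightarrow> sum f F \<le> b"
  shows "infsum f A \<le> b"
  unfolding nonneg_infsum_complete[of A f, OF zero_le] using assms by (intro SUP_least) auto

text \<open>Tonelli for counting measure. A finite set of pairs lies in a finite rectangle, which
  gives one inequality; for the other, finitely many full rows form the strip
  \<open>F \<times> B\<close>, over which the sum is additive row by row.\<close>

lemma infsum_Times_ennreal:
  fixes f :: "'a \<Rightarrow> 'b \<Rightarrow> ennreal"
  shows "infsum (\<lambda>(x, y). f x y) (A \<times> B) = infsum (\<lambda>x. infsum (f x) B) A"
proof (rule antisym)
  show "infsum (\<lambda>(x, y). f x y) (A \<times> B) \<le> infsum (\<lambda>x. infsum (f x) B) A"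
  proof (rule infsum_le_ennreal)
    fix G assume G: "finite G" "G \<subseteq> A \<times> B"
    have "sum (\<lambda>(x, y). f x y) G \<le> sum (\<lambda>(x, y). f x y) (fst ` G \<times> snd ` G)"
      using G by (intro sum_mono2) (force simp: image_iff)+
    also have "\<dots> = (\<Sum>x\<in>fst ` G. \<Sum>y\<in>snd ` G. f x y)"
      by (simp add: sum.cartesian_product)
    also have "\<dots> \<le> (\<Sum>x\<in>fst ` G. infsum (f x) B)"
      using G by (intro sum_mono sum_le_infsum_ennreal) auto
    also have "\<dots> \<le> infsum (\<lambda>x. infsum (f x) B) A"
      using G by (intro sum_le_infsum_ennreal) auto
    finally show "sum (\<lambda>(x, y). f x y) G \<le> infsum (\<lambda>x. infsum (f x) B) A" .
  qed
  show "infsum (\<lambda>x. infsum (f x) B) A \<le> infsum (\<lambda>(x, y). f x y) (A \<times> B)"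
  proof (rule infsum_le_ennreal)
    fix F assume F: "finite F" "F \<subseteq> A"
    have "(\<Sum>x\<in>F. infsum (f x) B) = infsum (\<lambda>(x, y). f x y) (F \<times> B)"
      using F(1)
    proof induction
      case (insert x F)
      have "insert x F \<times> B = ({x} \<times> B) \<union> (F \<times> B)" by auto
      then have "infsum (\<lambda>(x, y). f x y) (insert x F \<times> B) =
          infsum (\<lambda>(x, y). f x y) ({x} \<times> B) + infsum (\<lambda>(x, y). f x y) (F \<times> B)"
        using insert(2) by (simp only:, subst infsum_Un_disjoint) (auto intro: nonneg_summable_on_complete)
      moreover have "infsum (\<lambda>(x, y). f x y) ({x} \<times> B) = infsum (f x) B"
        by (rule infsum_reindex_bij_witness[of _ "Pair x" snd]) auto
      ultimately show ?case using insert by simp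
    qed simp
    also have "\<dots> \<le> infsum (\<lambda>(x, y). f x y) (A \<times> B)"
      using F by (intro infsum_mono_neutral nonneg_summable_on_complete) auto
    finally show "(\<Sum>x\<in>F. infsum (f x) B) \<le> infsum (\<lambda>(x, y). f x y) (A \<times> B)" .
  qed
qed

section \<open>The l2 norm and its finite sections\<close>

lemma ennreal_L2_set:
  "ennreal (L2_set (\<lambda>n. cmod (x n)) F) = ennreal_sqrt (\<Sum>n\<in>F. ennreal ((cmod (x n))\<^sup>2))"
  by (simp add: L2_set_def ennreal_sqrt_ennreal sum_nonneg)

lemma L2_set_le_l2_norm:
  assumes "finite F" "F \<subseteq> {1..}"
  shows "ennreal (L2_set (\<lambda>n. cmod (x n)) F) \<le> l2_norm x"
  unfolding ennreal_L2_set l2_norm_def using assms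
  by (intro ennreal_sqrt_mono sum_le_infsum_ennreal)

lemma l2_norm_leI:
  assumes "\<And>N. L2_set (\<lambda>n. cmod (x n)) {1..N} \<le> c"
  shows "l2_norm x \<le> ennreal c"
proof -
  \<comment> \<open>The empty section \<open>{1..0}\<close> has norm 0.\<close>
  have c: "0 \<le> c" using assms[of 0] by simp
  have "(\<Sum>\<^sub>\<infinity>n\<in>{1..}. ennreal ((cmod (x n))\<^sup>2)) \<le> ennreal (c\<^sup>2)"
  proof (rule infsum_le_ennreal)
    fix F :: "nat set" assume F: "finite F" "F \<subseteq> {1..}"
    \<comment> \<open>For empty \<open>F\<close> the value of \<open>Max F\<close> is unspecified,
      but the inclusion is trivial.\<close>
    have "F \<subseteq> {1..Max F}" using F by auto
    then have "(\<Sum>n\<in>F. (cmod (x n))\<^sup>2) \<le> (\<Sum>n=1..Max F. (cmod (x n))\<^sup>2)"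
      by (intro sum_mono2) auto
    also have "\<dots> = (L2_set (\<lambda>n. cmod (x n)) {1..Max F})\<^sup>2"
      by (simp add: L2_set_def sum_nonneg)
    also have "\<dots> \<le> c\<^sup>2" by (intro power_mono assms) simp
    finally show "(\<Sum>n\<in>F. ennreal ((cmod (x n))\<^sup>2)) \<le> ennreal (c\<^sup>2)"
      by (simp add: ennreal_leI)
  qed
  from ennreal_sqrt_mono[OF this] c show ?thesis
    by (simp add: l2_norm_def ennreal_sqrt_ennreal)
qed

lemma l2_norm_finite_support:
  assumes "finite F" "F \<subseteq> {1..}" "\<And>n. 1 \<le> n \<Longrightarrow> n \<notin> F \<Longrightarrow> x n = 0"
  shows "l2_norm x = ennreal (L2_set (\<lambda>n. cmod (x n)) F)"
proof -
  have "(\<Sum>\<^sub>\<infinity>n\<in>{1..}. ennreal ((cmod (x n))\<^sup>2)) = (\<Sum>\<^sub>\<infinity>n\<in>F. ennreal ((cmod (x n))\<^sup>2))"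
    using assms by (intro infsum_cong_neutral) auto
  then show ?thesis using assms(1) by (simp add: l2_norm_def ennreal_L2_set)
qed

text \<open>Replaces the extended norm by a real number that dominates all finite sections, so that
  the later estimates can be carried out in the reals.\<close>

lemma l2_norm_real:
  assumes "x \<in> l2"
  obtains r where "0 \<le> r" "l2_norm x = ennreal r"
    "\<And>F. finite F \<Longrightarrow> F \<subseteq> {1..} \<Longrightarrow> L2_set (\<lambda>n. cmod (x n)) F \<le> r"
proof -
  from assms have "l2_norm x < \<infinity>" by (simp add: l2_def)
  then obtain r where r: "0 \<le> r" "l2_norm x = ennreal r" by (cases "l2_norm x") auto
  show thesis
    by (rule that[OF r]) (use r L2_set_le_l2_norm[of _ x] in \<open>simp add: ennreal_le_iff\<close>)
qed

lemma dirichlet_polynomial_in_l2: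
  assumes "dirichlet_polynomial f"
  shows "f \<in> l2"
proof -
  have "l2_norm f = ennreal (L2_set (\<lambda>n. cmod (f n)) ({n. f n \<noteq> 0} \<inter> {1..}))"
    using assms by (intro l2_norm_finite_support) (auto simp: dirichlet_polynomial_def)
  then show ?thesis by (simp add: l2_def)
qed

lemma norm_sum_mult_le_L2_set:
  fixes f g :: "'a \<Rightarrow> complex"
  shows "cmod (\<Sum>i\<in>A. f i * g i) \<le> L2_set (\<lambda>i. cmod (f i)) A * L2_set (\<lambda>i. cmod (g i)) A"
proof -
  have "cmod (\<Sum>i\<in>A. f i * g i) \<le> (\<Sum>i\<in>A. \<bar>cmod (f i)\<bar> * \<bar>cmod (g i)\<bar>)"
    by (rule order_trans[OF norm_sum]) (simp add: norm_mult)
  also note L2_set_mult_ineq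
  finally show ?thesis .
qed

lemma L2_set_reindex: "inj_on h A \<Longrightarrow> L2_set f (h ` A) = L2_set (\<lambda>i. f (h i)) A"
  by (simp add: L2_set_def sum.reindex)

text \<open>The sum of squares of a rank-one array factors. This will bound the terms f(p)g(q), in
  which row and column index separate.\<close>

lemma L2_set_product:
  "L2_set (\<lambda>(j, k). u j * v k) (A \<times> B) = L2_set u A * L2_set v B"
  unfolding L2_set_def real_sqrt_mult[symmetric] sum_product sum.cartesian_product
  by (simp add: power_mult_distrib case_prod_unfold)

section \<open>Products of a prime of odd index and a prime of even index\<close>

lemma prime_nth_prime: "prime (nth_prime i)"
  using enumerate_in_set[OF primes_infinite] by (simp add: nth_prime_def)

lemma nth_prime_eq_iff:
  assumes "1 \<le> i" "1 \<le> j"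
  shows "nth_prime i = nth_prime j \<longleftrightarrow> i = j"
proof -
  have "nth_prime i = nth_prime j \<longleftrightarrow> i - 1 = j - 1"
    unfolding nth_prime_def by (rule inj_eq[OF inj_enumerate[OF primes_infinite]])
  with assms show ?thesis by auto
qed

text \<open>Bounds an index by its prime: a bound on pq then bounds both indices, so that only a
  finite square of matrix entries meets a given polynomial.\<close>

lemma le_nth_prime: "i \<le> nth_prime i"
proof -
  have "Suc n \<le> enumerate {p::nat. prime p} n" for n
  proof (induction n)
    case 0
    show ?case using prime_ge_1_nat[OF prime_nth_prime[of 1]] by (simp add: nth_prime_def)
  next
    case (Suc n)
    show ?case
      using Suc enumerate_step[OF primes_infinite, of n] by linarith
  qed
  from this[of "i - 1"] show ?thesis by (simp add: nth_prime_def)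
qed

text \<open>At index 0 truncated subtraction makes \<open>odd_prime 0\<close>,
  \<open>odd_prime 1\<close> and \<open>even_prime 0\<close> all equal to 2; hence the hypotheses
  that indices are at least 1 below.\<close>

definition odd_prime :: "nat \<Rightarrow> nat" where "odd_prime j = nth_prime (2 * j - 1)"

definition even_prime :: "nat \<Rightarrow> nat" where "even_prime k = nth_prime (2 * k)"

lemma prime_odd_prime: "prime (odd_prime j)"
  and prime_even_prime: "prime (even_prime j)"
  by (simp_all add: odd_prime_def even_prime_def prime_nth_prime)

lemma odd_prime_ge_one: "1 \<le> odd_prime j"
  and even_prime_ge_one: "1 \<le> even_prime j"
  using prime_ge_1_nat prime_odd_prime prime_even_prime by blast+

lemma odd_prime_pos: "0 < odd_prime j"
  and even_prime_pos: "0 < even_prime j"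
  using odd_prime_ge_one[of j] even_prime_ge_one[of j] by auto

lemma odd_prime_neq_even_prime: "1 \<le> j \<Longrightarrow> 1 \<le> k \<Longrightarrow> odd_prime j \<noteq> even_prime k"
  unfolding odd_prime_def even_prime_def by (subst nth_prime_eq_iff) presburger+

lemma odd_prime_eq_iff: "1 \<le> i \<Longrightarrow> 1 \<le> j \<Longrightarrow> odd_prime i = odd_prime j \<longleftrightarrow> i = j"
  unfolding odd_prime_def by (subst nth_prime_eq_iff) auto

lemma even_prime_eq_iff: "1 \<le> i \<Longrightarrow> 1 \<le> j \<Longrightarrow> even_prime i = even_prime j \<longleftrightarrow> i = j"
  unfolding even_prime_def by (subst nth_prime_eq_iff) auto

lemma inj_on_odd_prime: "inj_on odd_prime {1..}"
  by (rule inj_onI) (metis atLeast_iff odd_prime_eq_iff)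

lemma inj_on_even_prime: "inj_on even_prime {1..}"
  by (rule inj_onI) (metis atLeast_iff even_prime_eq_iff)

lemma le_odd_prime: "1 \<le> j \<Longrightarrow> j \<le> odd_prime j"
  unfolding odd_prime_def by (rule order_trans[OF _ le_nth_prime]) auto

lemma le_even_prime: "k \<le> even_prime k"
  unfolding even_prime_def by (rule order_trans[OF _ le_nth_prime]) auto

section \<open>Coefficients of the symbol\<close>

lemma matrix_series_altdef:
  "matrix_series C n =
    (\<Sum>(j, k) \<in> {(j, k). 1 \<le> j \<and> 1 \<le> k \<and> odd_prime j * even_prime k = n}. C j k)"
  by (simp add: matrix_series_def odd_prime_def even_prime_def)

text \<open>Unique factorization: the odd-indexed prime on the left divides the right side, so it is
  one of the two primes there, and it cannot be the even-indexed one. Cancelling it identifies the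
  other factor.\<close>

lemma odd_even_product_eq_iff:
  assumes "1 \<le> j" "1 \<le> k" "1 \<le> j'" "1 \<le> k'"
  shows "odd_prime j * even_prime k = odd_prime j' * even_prime k' \<longleftrightarrow> j = j' \<and> k = k'"
proof
  assume eq: "odd_prime j * even_prime k = odd_prime j' * even_prime k'"
  have "odd_prime j dvd odd_prime j' * even_prime k'"
    unfolding eq[symmetric] by simp
  then have "odd_prime j = odd_prime j' \<or> odd_prime j = even_prime k'"
    by (metis prime_odd_prime prime_even_prime prime_dvd_mult_iff primes_dvd_imp_eq)
  then have j: "j = j'"
    using assms odd_prime_neq_even_prime odd_prime_eq_iff by blast
  with eq odd_prime_pos[of j] have "even_prime k = even_prime k'" by auto
  with j assms even_prime_eq_iff show "j = j' \<and> k = k'" by blast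
qed simp

lemma inj_on_odd_even_product:
  "inj_on (\<lambda>(j, k). odd_prime j * even_prime k) ({1..} \<times> {1..})"
  by (rule inj_onI) (clarsimp simp: odd_even_product_eq_iff[simplified])

lemma matrix_series_product:
  assumes "1 \<le> j" "1 \<le> k"
  shows "matrix_series C (odd_prime j * even_prime k) = C j k"
proof -
  have "{(j', k'). 1 \<le> j' \<and> 1 \<le> k' \<and>
      odd_prime j' * even_prime k' = odd_prime j * even_prime k} = {(j, k)}"
    using assms odd_even_product_eq_iff by auto
  then show ?thesis by (simp add: matrix_series_altdef)
qed

lemma matrix_series_nonzeroE:
  assumes "matrix_series C n \<noteq> 0"
  obtains j k where "1 \<le> j" "1 \<le> k" "n = odd_prime j * even_prime k"
proof -
  have "{(j, k). 1 \<le> j \<and> 1 \<le> k \<and> odd_prime j * even_prime k = n} \<noteq> {}"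
    using assms unfolding matrix_series_altdef by (metis sum.empty)
  then show thesis using that by auto
qed

text \<open>The nonzero coefficients of the symbol are the nonzero matrix entries, moved along the
  injection (j, k) \<mapsto> pq; Tonelli turns the sum over pairs into the iterated sum.\<close>

lemma hilbert_schmidt_norm_eq_l2_norm: "hilbert_schmidt_norm C = l2_norm (matrix_series C)"
proof -
  let ?pq = "\<lambda>(j, k). odd_prime j * even_prime k"
  have "(\<Sum>\<^sub>\<infinity>n\<in>{1..}. ennreal ((cmod (matrix_series C n))\<^sup>2)) =
      (\<Sum>\<^sub>\<infinity>n\<in>?pq ` ({1..} \<times> {1..}). ennreal ((cmod (matrix_series C n))\<^sup>2))"
  proof (rule infsum_cong_neutral)
    fix n assume "n \<in> ?pq ` ({1..} \<times> {1..}) - {1..}"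
    then show "ennreal ((cmod (matrix_series C n))\<^sup>2) = 0"
      by (auto simp: Suc_le_eq odd_prime_pos even_prime_pos odd_prime_pos[THEN gr_implies_not0] even_prime_pos[THEN gr_implies_not0])
  next
    fix n assume n: "n \<in> {1..} - ?pq ` ({1..} \<times> {1..})"
    have "matrix_series C n = 0"
    proof (rule ccontr)
      assume "matrix_series C n \<noteq> 0"
      then obtain j k where "1 \<le> j" "1 \<le> k" "n = odd_prime j * even_prime k"
        by (rule matrix_series_nonzeroE)
      then have "n \<in> ?pq ` ({1..} \<times> {1..})" by (intro image_eqI[of _ _ "(j, k)"]) auto
      with n show False by blast
    qed
    then show "ennreal ((cmod (matrix_series C n))\<^sup>2) = 0" by simp
  qed simp
  also have "\<dots> = (\<Sum>\<^sub>\<infinity>(j, k)\<in>{1..} \<times> {1..}. ennreal ((cmod (C j k))\<^sup>2))"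
    unfolding infsum_reindex[OF inj_on_odd_even_product]
    by (intro infsum_cong) (auto simp: matrix_series_product)
  also have "\<dots> = (\<Sum>\<^sub>\<infinity>j\<in>{1..}. \<Sum>\<^sub>\<infinity>k\<in>{1..}. ennreal ((cmod (C j k))\<^sup>2))"
    by (rule infsum_Times_ennreal)
  finally show ?thesis by (simp add: hilbert_schmidt_norm_def l2_norm_def)
qed

section \<open>The Hankel form\<close>

lemma divisors_of_prime_product:
  fixes p q :: nat
  assumes "prime p" "prime q"
  shows "{d. d dvd p * q} = {1, p, q, p * q}"
proof (rule set_eqI)
  fix d
  have "d dvd p * q \<longleftrightarrow> d = 1 \<or> d = p \<or> d = q \<or> d = p * q"
  proof
    assume "d dvd p * q"
    then obtain a b where "d = a * b" "a dvd p" "b dvd q"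
      using division_decomp by blast
    moreover from this have "a = 1 \<or> a = p" "b = 1 \<or> b = q"
      using assms prime_nat_iff by blast+
    ultimately show "d = 1 \<or> d = p \<or> d = q \<or> d = p * q" by auto
  qed auto
  then show "d \<in> {d. d dvd p * q} \<longleftrightarrow> d \<in> {1, p, q, p * q}" by simp
qed

lemma dirichlet_mult_prime_product:
  assumes "prime p" "prime q" "p \<noteq> q"
  shows "dirichlet_mult f g (p * q) = f 1 * g (p * q) + f p * g q + f q * g p + f (p * q) * g 1"
proof -
  have "1 < p" "1 < q" using assms prime_gt_1_nat by auto
  \<comment> \<open>With \<open>p \<noteq> q\<close>, these make the four divisors distinct, so that
    each contributes its own summand.\<close>
  then have "p * q \<noteq> p" "p * q \<noteq> q" "p * q \<noteq> 1" "1 \<noteq> p" "1 \<noteq> q" "0 < p" "0 < q" by auto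
  then show ?thesis
    using assms(3) unfolding dirichlet_mult_def divisors_of_prime_product[OF assms(1,2)]
    by (simp add: add.assoc)
qed

lemma dirichlet_mult_nonzeroE:
  assumes "dirichlet_mult f g n \<noteq> 0" "1 \<le> n"
  obtains d e where "f d \<noteq> 0" "g e \<noteq> 0" "n = d * e"
proof -
  have "\<exists>d\<in>{d. d dvd n}. f d * g (n div d) \<noteq> 0"
    using assms(1) unfolding dirichlet_mult_def by (metis (no_types, lifting) sum.neutral)
  then show thesis using that by force
qed

text \<open>The product of two polynomials has finite support, so the form is a finite sum over a
  square of indices. Every larger square gives the same value, which lets one enlarge it to contain
  a prescribed rectangle.\<close>

lemma hankel_form_matrix_series:
  assumes "dirichlet_polynomial f" "dirichlet_polynomial g"
  shows "\<exists>N0. \<forall>N\<ge>N0. hankel_form (matrix_series C) f g =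
    (\<Sum>j=1..N. \<Sum>k=1..N. (f 1 * g (odd_prime j * even_prime k) + f (odd_prime j) * g (even_prime k)
      + f (even_prime k) * g (odd_prime j) + f (odd_prime j * even_prime k) * g 1) * cnj (C j k))"
proof -
  define D where "D = (\<lambda>(d, e). d * e) ` ({d. f d \<noteq> 0} \<times> {e. g e \<noteq> 0})"
  have "finite D" using assms by (simp add: D_def dirichlet_polynomial_def)
  have D: "n \<in> D" if nz: "dirichlet_mult f g n \<noteq> 0" "1 \<le> n" for n
    using nz by (rule dirichlet_mult_nonzeroE) (auto simp: D_def)
  show ?thesis
  proof (intro exI allI impI)
    \<comment> \<open>Inserting 0 makes the maximum meaningful for empty \<open>D\<close>. If
      \<open>n = odd_prime j * even_prime k\<close> lies in \<open>D\<close>, then \<open>j\<close>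
      and \<open>k\<close> are at most \<open>n\<close>, hence at most \<open>N\<close>.\<close>
    fix N assume N: "Max (insert 0 D) \<le> N"
    let ?pq = "\<lambda>(j, k). odd_prime j * even_prime k"
    let ?T = "{1..N} \<times> {1..N}"
    have inj: "inj_on ?pq ?T"
      by (rule inj_on_subset[OF inj_on_odd_even_product]) auto
    have "hankel_form (matrix_series C) f g =
        (\<Sum>\<^sub>\<infinity>n\<in>?pq ` ?T. dirichlet_mult f g n * cnj (matrix_series C n))"
      unfolding hankel_form_def H2_inner_def
    proof (rule infsum_cong_neutral)
      fix n assume "n \<in> ?pq ` ?T - {1..}"
      then show "dirichlet_mult f g n * cnj (matrix_series C n) = 0"
        by (auto simp: Suc_le_eq odd_prime_pos even_prime_pos odd_prime_pos[THEN gr_implies_not0] even_prime_pos[THEN gr_implies_not0])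
    next
      fix n assume n: "n \<in> {1..} - ?pq ` ?T"
      show "dirichlet_mult f g n * cnj (matrix_series C n) = 0"
      proof (rule ccontr)
        assume nz: "dirichlet_mult f g n * cnj (matrix_series C n) \<noteq> 0"
        then have "matrix_series C n \<noteq> 0" by auto
        then obtain j k where jk: "1 \<le> j" "1 \<le> k" "n = odd_prime j * even_prime k"
          by (rule matrix_series_nonzeroE)
        have "n \<in> D" using nz n by (intro D) auto
        then have "n \<le> N" using N \<open>finite D\<close> by auto
        moreover have "odd_prime j \<le> n" "even_prime k \<le> n"
          using jk odd_prime_pos even_prime_pos by (auto simp: Suc_le_eq)
        ultimately have "j \<le> N" "k \<le> N"
          using le_odd_prime[OF jk(1)] le_even_prime[of k] by linarith+
        then have "n \<in> ?pq ` ?T" using jk by (intro image_eqI[of _ _ "(j, k)"]) auto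
        with n show False by blast
      qed
    qed simp
    also have "\<dots> = (\<Sum>n\<in>?pq ` ?T. dirichlet_mult f g n * cnj (matrix_series C n))"
      by simp
    also have "\<dots> = (\<Sum>(j, k)\<in>?T. dirichlet_mult f g (odd_prime j * even_prime k) *
        cnj (matrix_series C (odd_prime j * even_prime k)))"
      unfolding sum.reindex[OF inj] by (intro sum.cong) auto
    also have "\<dots> = (\<Sum>j=1..N. \<Sum>k=1..N. dirichlet_mult f g (odd_prime j * even_prime k) *
        cnj (matrix_series C (odd_prime j * even_prime k)))"
      by (simp add: sum.cartesian_product)
    also have "\<dots> = (\<Sum>j=1..N. \<Sum>k=1..N.
        (f 1 * g (odd_prime j * even_prime k) + f (odd_prime j) * g (even_prime k)
          + f (even_prime k) * g (odd_prime j) + f (odd_prime j * even_prime k) * g 1) * cnj (C j k))"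
      by (intro sum.cong refl, subst matrix_series_product,
        simp_all add: dirichlet_mult_prime_product prime_odd_prime prime_even_prime odd_prime_neq_even_prime)
    finally show "hankel_form (matrix_series C) f g = \<dots>" .
  qed
qed

lemma hankel_norm_leI:
  assumes "\<And>f g. f \<in> X \<Longrightarrow> g \<in> X \<Longrightarrow> dirichlet_polynomial f \<Longrightarrow> dirichlet_polynomial g \<Longrightarrow>
    ennreal (cmod (hankel_form \<phi> f g)) \<le> c * l2_norm f * l2_norm g"
  shows "hankel_norm X \<phi> \<le> c"
  unfolding hankel_norm_def using assms by (intro Inf_lower) auto

section \<open>The form on series without constant term\<close>

lemma bilinear_bound:
  assumes K: "\<And>x. x \<in> l2 \<Longrightarrow> l2_norm (matrix_apply C x) \<le> ennreal K * l2_norm x" and "0 \<le> K"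
  shows "cmod (\<Sum>j=1..N. \<Sum>k=1..N. x j * y k * cnj (C j k)) \<le>
    K * (L2_set (\<lambda>j. cmod (x j)) {1..N} * L2_set (\<lambda>k. cmod (y k)) {1..N})"
proof -
  \<comment> \<open>The conjugate compensates for \<open>cnj (C j k)\<close>: summing over
    \<open>k\<close> turns the form into the pairing of \<open>x\<close> with the conjugate of
    \<open>matrix_apply C v\<close>, and Cauchy--Schwarz applies.\<close>
  define v where "v k = (if k \<in> {1..N} then cnj (y k) else 0)" for k
  have v: "l2_norm v = ennreal (L2_set (\<lambda>k. cmod (y k)) {1..N})"
    by (subst l2_norm_finite_support[of "{1..N}"]) (auto simp: v_def intro!: L2_set_cong)
  have Cv: "matrix_apply C v j = (\<Sum>k=1..N. C j k * cnj (y k))" for j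
  proof -
    have "matrix_apply C v j = (\<Sum>\<^sub>\<infinity>k\<in>{1..N}. C j k * cnj (y k))"
      unfolding matrix_apply_def by (rule infsum_cong_neutral) (auto simp: v_def)
    then show ?thesis by simp
  qed
  have "ennreal (L2_set (\<lambda>j. cmod (matrix_apply C v j)) {1..N}) \<le> l2_norm (matrix_apply C v)"
    by (rule L2_set_le_l2_norm) auto
  also have "\<dots> \<le> ennreal K * l2_norm v"
    by (rule K) (simp add: l2_def v)
  finally have le: "L2_set (\<lambda>j. cmod (matrix_apply C v j)) {1..N} \<le> K * L2_set (\<lambda>k. cmod (y k)) {1..N}"
    using \<open>0 \<le> K\<close> by (simp add: v ennreal_mult[symmetric] ennreal_le_iff)
  have "(\<Sum>j=1..N. \<Sum>k=1..N. x j * y k * cnj (C j k)) = (\<Sum>j=1..N. x j * cnj (matrix_apply C v j))"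
    by (simp add: Cv sum_distrib_left mult_ac)
  also have "cmod \<dots> \<le> L2_set (\<lambda>j. cmod (x j)) {1..N} *
      L2_set (\<lambda>j. cmod (cnj (matrix_apply C v j))) {1..N}"
    by (rule norm_sum_mult_le_L2_set)
  also have "\<dots> \<le> L2_set (\<lambda>j. cmod (x j)) {1..N} * (K * L2_set (\<lambda>k. cmod (y k)) {1..N})"
    using le by (intro mult_left_mono) auto
  finally show ?thesis by (simp add: mult_ac)
qed

lemma L2_set_Un_disjoint:
  assumes "finite A" "finite B" "A \<inter> B = {}"
  shows "(L2_set f A)\<^sup>2 + (L2_set f B)\<^sup>2 = (L2_set f (A \<union> B))\<^sup>2"
  using assms by (simp add: L2_set_def sum_nonneg sum.union_disjoint)

text \<open>Disjointness of the two sets of primes bounds the sum of the squares, not only each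
  square separately; this is what keeps the constant equal to 1 in (a).\<close>

lemma L2_set_odd_even_primes_le:
  assumes "\<And>F. finite F \<Longrightarrow> F \<subseteq> {1..} \<Longrightarrow> L2_set (\<lambda>n. cmod (f n)) F \<le> r"
  shows "(L2_set (\<lambda>j. cmod (f (odd_prime j))) {1..N})\<^sup>2 +
    (L2_set (\<lambda>k. cmod (f (even_prime k))) {1..N})\<^sup>2 \<le> r\<^sup>2"
proof -
  have "odd_prime ` {1..N} \<inter> even_prime ` {1..N} = {}"
    using odd_prime_neq_even_prime by fastforce
  moreover have "inj_on odd_prime {1..N}" "inj_on even_prime {1..N}"
    by (auto intro: inj_on_subset[OF inj_on_odd_prime] inj_on_subset[OF inj_on_even_prime])
  ultimately have "(L2_set (\<lambda>j. cmod (f (odd_prime j))) {1..N})\<^sup>2 +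
      (L2_set (\<lambda>k. cmod (f (even_prime k))) {1..N})\<^sup>2 =
      (L2_set (\<lambda>n. cmod (f n)) (odd_prime ` {1..N} \<union> even_prime ` {1..N}))\<^sup>2"
    by (simp add: L2_set_Un_disjoint[symmetric] L2_set_reindex)
  also have "\<dots> \<le> r\<^sup>2"
    by (intro power_mono assms) (auto simp: Suc_le_eq odd_prime_pos even_prime_pos)
  finally show ?thesis .
qed

lemma hankel_norm_le_operator_norm: "hankel_norm H2_0 (matrix_series C) \<le> operator_norm C"
  unfolding operator_norm_def
proof (rule Inf_greatest)
  fix K' assume K': "K' \<in> {K. \<forall>x\<in>l2. l2_norm (matrix_apply C x) \<le> K * l2_norm x}"
  show "hankel_norm H2_0 (matrix_series C) \<le> K'"
  proof (cases K')
    case (real K)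
    have K: "l2_norm (matrix_apply C x) \<le> ennreal K * l2_norm x" if "x \<in> l2" for x
      using K' real that by simp
    show ?thesis unfolding real(2)
    proof (rule hankel_norm_leI)
      fix f g assume "f \<in> H2_0" "g \<in> H2_0" and fg: "dirichlet_polynomial f" "dirichlet_polynomial g"
      then have zero: "f 1 = 0" "g 1 = 0" by (auto simp: H2_0_def)
      obtain N0 where "\<forall>N\<ge>N0. hankel_form (matrix_series C) f g =
          (\<Sum>j=1..N. \<Sum>k=1..N. (f 1 * g (odd_prime j * even_prime k) + f (odd_prime j) * g (even_prime k)
          + f (even_prime k) * g (odd_prime j) + f (odd_prime j * even_prime k) * g 1) * cnj (C j k))"
        using hankel_form_matrix_series[OF fg] by blast
      \<comment> \<open>In the second sum the roles of \<open>f\<close> and \<open>g\<close> are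
        exchanged, so that both sums have the shape of \<open>bilinear_bound\<close>, with
        odd-indexed primes on the rows.\<close>
      then have form: "hankel_form (matrix_series C) f g =
          (\<Sum>j=1..N0. \<Sum>k=1..N0. f (odd_prime j) * g (even_prime k) * cnj (C j k)) +
          (\<Sum>j=1..N0. \<Sum>k=1..N0. g (odd_prime j) * f (even_prime k) * cnj (C j k))"
        unfolding zero by (simp add: sum.distrib[symmetric] algebra_simps)
      obtain r where r: "0 \<le> r" "l2_norm f = ennreal r"
        "\<And>F. finite F \<Longrightarrow> F \<subseteq> {1..} \<Longrightarrow> L2_set (\<lambda>n. cmod (f n)) F \<le> r"
        using l2_norm_real[OF dirichlet_polynomial_in_l2[OF fg(1)]] by metis
      obtain s where s: "0 \<le> s" "l2_norm g = ennreal s"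
        "\<And>F. finite F \<Longrightarrow> F \<subseteq> {1..} \<Longrightarrow> L2_set (\<lambda>n. cmod (g n)) F \<le> s"
        using l2_norm_real[OF dirichlet_polynomial_in_l2[OF fg(2)]] by metis
      define a where "a = L2_set (\<lambda>j. cmod (f (odd_prime j))) {1..N0}"
      define b where "b = L2_set (\<lambda>j. cmod (f (even_prime j))) {1..N0}"
      define u where "u = L2_set (\<lambda>j. cmod (g (odd_prime j))) {1..N0}"
      define v where "v = L2_set (\<lambda>j. cmod (g (even_prime j))) {1..N0}"
      have ab: "a\<^sup>2 + b\<^sup>2 \<le> r\<^sup>2" unfolding a_def b_def by (rule L2_set_odd_even_primes_le[OF r(3)])
      have uv: "u\<^sup>2 + v\<^sup>2 \<le> s\<^sup>2" unfolding u_def v_def by (rule L2_set_odd_even_primes_le[OF s(3)])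
      \<comment> \<open>The difference of the two sides is the square of
        \<open>a * u - b * v\<close>.\<close>
      have "(a * v + u * b)\<^sup>2 \<le> (a\<^sup>2 + b\<^sup>2) * (u\<^sup>2 + v\<^sup>2)"
        using zero_le_power2[of "a * u - b * v"] by (simp add: power2_eq_square algebra_simps)
      also have "\<dots> \<le> r\<^sup>2 * s\<^sup>2" using ab uv by (intro mult_mono) auto
      finally have abuv: "a * v + u * b \<le> r * s"
        using r(1) s(1) by (intro power2_le_imp_le[of "a * v + u * b" "r * s"]) (simp_all add: power_mult_distrib)
      have "cmod (hankel_form (matrix_series C) f g) \<le> K * (a * v) + K * (u * b)"
        unfolding form a_def b_def u_def v_def
        by (rule order_trans[OF norm_triangle_ineq]) (intro add_mono bilinear_bound K real(1))
      also have "\<dots> \<le> K * r * s"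
        using mult_left_mono[OF abuv real(1)] by (simp add: algebra_simps)
      finally show "ennreal (cmod (hankel_form (matrix_series C) f g)) \<le> ennreal K * l2_norm f * l2_norm g"
        using real(1) r(1) s(1) by (simp add: r(2) s(2) ennreal_mult[symmetric] ennreal_leI)
    qed
  qed simp
qed

section \<open>Lower bound by finite sections of the matrix\<close>

text \<open>Transports \<open>x\<close> along \<open>h\<close>, cut off after \<open>N\<close>.
  Summing over preimages avoids an inverse of \<open>h\<close>; for the injections used here the sum
  has at most one term.\<close>

definition place_on :: "(nat \<Rightarrow> nat) \<Rightarrow> nat \<Rightarrow> (nat \<Rightarrow> complex) \<Rightarrow> dirichlet_series" where
  "place_on h N x n = (\<Sum>i | i \<in> {1..N} \<and> h i = n. x i)"

lemma place_on_image:
  assumes "inj_on h {1..}" "1 \<le> i"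
  shows "place_on h N x (h i) = (if i \<le> N then x i else 0)"
proof -
  have "{i'. i' \<in> {1..N} \<and> h i' = h i} = (if i \<le> N then {i} else {})"
    using assms by (auto simp: inj_on_eq_iff)
  then show ?thesis by (simp add: place_on_def)
qed

lemma place_on_outside: "(\<And>i. 1 \<le> i \<Longrightarrow> h i \<noteq> n) \<Longrightarrow> place_on h N x n = 0"
  unfolding place_on_def by (rule sum.neutral) auto

lemma dirichlet_polynomial_place_on: "dirichlet_polynomial (place_on h N x)"
proof -
  have "{n. place_on h N x n \<noteq> 0} \<subseteq> h ` {1..N}"
    unfolding place_on_def by (auto elim: sum.not_neutral_contains_not_neutral)
  then show ?thesis
    unfolding dirichlet_polynomial_def by (rule finite_subset) simp
qed

lemma l2_norm_place_on:
  assumes "inj_on h {1..}" "\<And>i. 1 \<le> i \<Longrightarrow> 1 \<le> h i"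
  shows "l2_norm (place_on h N x) = ennreal (L2_set (\<lambda>i. cmod (x i)) {1..N})"
proof -
  have "l2_norm (place_on h N x) = ennreal (L2_set (\<lambda>n. cmod (place_on h N x n)) (h ` {1..N}))"
    using assms(2) by (intro l2_norm_finite_support) (auto simp: place_on_def intro!: sum.neutral)
  also have "L2_set (\<lambda>n. cmod (place_on h N x n)) (h ` {1..N}) =
      L2_set (\<lambda>i. cmod (place_on h N x (h i))) {1..N}"
    by (rule L2_set_reindex) (auto intro: inj_on_subset[OF assms(1)])
  also have "\<dots> = L2_set (\<lambda>i. cmod (x i)) {1..N}"
    by (intro L2_set_cong) (auto simp: place_on_image[OF assms(1)])
  finally show ?thesis .
qed

text \<open>With \<open>f\<close> on odd-indexed and \<open>g\<close> on even-indexed primes,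
  f(p)g(q) is the only surviving term. Independent lengths \<open>M\<close> and \<open>N\<close>
  allow a limit in the columns while the rows stay fixed.\<close>

lemma finite_section_bound:
  assumes K: "\<And>f g. f \<in> H2_0 \<Longrightarrow> g \<in> H2_0 \<Longrightarrow> dirichlet_polynomial f \<Longrightarrow> dirichlet_polynomial g \<Longrightarrow>
      ennreal (cmod (hankel_form (matrix_series C) f g)) \<le> ennreal K * l2_norm f * l2_norm g"
    and "0 \<le> K"
  shows "cmod (\<Sum>j=1..M. \<Sum>k=1..N. x j * y k * cnj (C j k)) \<le>
    K * L2_set (\<lambda>j. cmod (x j)) {1..M} * L2_set (\<lambda>k. cmod (y k)) {1..N}"
proof -
  define f where "f = place_on odd_prime M x"
  define g where "g = place_on even_prime N y"
  have fg: "dirichlet_polynomial f" "dirichlet_polynomial g"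
    by (auto simp: f_def g_def dirichlet_polynomial_place_on)
  have f: "f (odd_prime j) = (if j \<le> M then x j else 0)" "f (even_prime j) = 0" if "1 \<le> j" for j
    unfolding f_def using that place_on_image[OF inj_on_odd_prime]
    by (auto intro!: place_on_outside dest: odd_prime_neq_even_prime)
  have g: "g (even_prime k) = (if k \<le> N then y k else 0)" "g (odd_prime k) = 0" if "1 \<le> k" for k
    unfolding g_def using that place_on_image[OF inj_on_even_prime]
    by (auto intro!: place_on_outside dest: odd_prime_neq_even_prime[OF that] sym)
  have "odd_prime i \<noteq> 1" "even_prime i \<noteq> 1" for i
    using prime_odd_prime[of i] prime_even_prime[of i] by auto
  then have one: "f 1 = 0" "g 1 = 0"
    unfolding f_def g_def by (auto intro!: place_on_outside)
  have norms: "l2_norm f = ennreal (L2_set (\<lambda>j. cmod (x j)) {1..M})"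
    "l2_norm g = ennreal (L2_set (\<lambda>k. cmod (y k)) {1..N})"
    unfolding f_def g_def
    by (intro l2_norm_place_on inj_on_odd_prime inj_on_even_prime odd_prime_ge_one even_prime_ge_one)+
  obtain N0 where N0: "\<forall>N\<ge>N0. hankel_form (matrix_series C) f g =
      (\<Sum>j=1..N. \<Sum>k=1..N. (f 1 * g (odd_prime j * even_prime k) + f (odd_prime j) * g (even_prime k)
      + f (even_prime k) * g (odd_prime j) + f (odd_prime j * even_prime k) * g 1) * cnj (C j k))"
    using hankel_form_matrix_series[OF fg] by blast
  \<comment> \<open>The square must exceed the threshold \<open>N0\<close> and contain the
    \<open>M\<close> by \<open>N\<close> rectangle.\<close>
  define L where "L = max N0 (max M N)"
  have "hankel_form (matrix_series C) f g =
      (\<Sum>j=1..L. \<Sum>k=1..L. (f 1 * g (odd_prime j * even_prime k) + f (odd_prime j) * g (even_prime k)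
      + f (even_prime k) * g (odd_prime j) + f (odd_prime j * even_prime k) * g 1) * cnj (C j k))"
    by (rule N0[rule_format]) (simp add: L_def)
  also have "\<dots> = (\<Sum>j=1..L. \<Sum>k=1..L. f (odd_prime j) * g (even_prime k) * cnj (C j k))"
    by (intro sum.cong refl) (auto simp: one[simplified] f(2) g(2))
  also have "\<dots> = (\<Sum>j=1..M. \<Sum>k=1..N. x j * y k * cnj (C j k))"
    unfolding sum.cartesian_product
    by (rule sum.mono_neutral_cong_right) (auto simp: f g L_def split: if_splits)
  finally have "ennreal (cmod (\<Sum>j=1..M. \<Sum>k=1..N. x j * y k * cnj (C j k))) \<le>
      ennreal K * l2_norm f * l2_norm g"
    using K[OF _ _ fg] one fg by (simp add: H2_0_def H2_def dirichlet_polynomial_in_l2)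
  then show ?thesis
    using \<open>0 \<le> K\<close> by (simp add: norms ennreal_mult[symmetric] ennreal_le_iff)
qed

text \<open>The section bound passes to the limit \<open>N \<rightarrow> \<infinity>\<close> for
  fixed \<open>M\<close>, and then holds for all \<open>M\<close>. The hypothesis makes each row sum
  converge; a divergent one would get the default value 0 instead of a limit.\<close>

lemma operator_norm_le_hankel_norm:
  assumes "l2_operator C"
  shows "operator_norm C \<le> hankel_norm H2_0 (matrix_series C)"
  unfolding hankel_norm_def
proof (rule Inf_greatest, elim CollectE)
  fix K' assume K': "\<forall>f\<in>H2_0. \<forall>g\<in>H2_0. dirichlet_polynomial f \<longrightarrow> dirichlet_polynomial g \<longrightarrow>
    ennreal (cmod (hankel_form (matrix_series C) f g)) \<le> K' * l2_norm f * l2_norm g"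
  show "operator_norm C \<le> K'"
  proof (cases K')
    case (real K)
    note section_bound = finite_section_bound[of C K, OF _ real(1)]
    have "l2_norm (matrix_apply C x) \<le> ennreal K * l2_norm x" if x: "x \<in> l2" for x
    proof -
      obtain r where r: "0 \<le> r" "l2_norm x = ennreal r"
        "\<And>F. finite F \<Longrightarrow> F \<subseteq> {1..} \<Longrightarrow> L2_set (\<lambda>n. cmod (x n)) F \<le> r"
        using l2_norm_real[OF x] by metis
      \<comment> \<open>Dualize: pair the truncated image with itself.\<close>
      have partial: "L2_set (\<lambda>j. cmod (\<Sum>k=1..N. C j k * x k)) {1..M} \<le> K * r" for M N
      proof -
        define w where "w j = (\<Sum>k=1..N. C j k * x k)" for j
        define A where "A = L2_set (\<lambda>j. cmod (w j)) {1..M}"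
        have "complex_of_real (A\<^sup>2) = (\<Sum>j=1..M. w j * cnj (w j))"
          by (simp add: A_def L2_set_def sum_nonneg complex_mult_cnj cmod_power2)
        also have "\<dots> = (\<Sum>j=1..M. \<Sum>k=1..N. w j * cnj (x k) * cnj (C j k))"
          by (simp add: w_def[abs_def] sum_distrib_left mult_ac)
        finally have "A\<^sup>2 = cmod (\<Sum>j=1..M. \<Sum>k=1..N. w j * cnj (x k) * cnj (C j k))"
          by (metis norm_of_real abs_of_nonneg zero_le_power2)
        also have "\<dots> \<le> K * A * L2_set (\<lambda>k. cmod (cnj (x k))) {1..N}"
          unfolding A_def by (rule section_bound) (use K' real in auto)
        also have "\<dots> \<le> K * A * r"
          using r(3)[of "{1..N}"] real(1) by (intro mult_left_mono) (auto simp: A_def)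
        finally have "A * A \<le> A * (K * r)" by (simp add: power2_eq_square mult_ac)
        moreover have "0 \<le> A" by (simp add: A_def)
        \<comment> \<open>One factor \<open>A\<close> is cancelled; for \<open>A = 0\<close> the
          bound is just nonnegativity of \<open>K * r\<close>.\<close>
        ultimately have "A \<le> K * r"
          using r(1) real(1) by (cases "A = 0") (auto simp: mult_le_cancel_left)
        then show ?thesis by (simp add: A_def w_def)
      qed
      have "l2_norm (matrix_apply C x) \<le> ennreal (K * r)"
      proof (rule l2_norm_leI)
        fix M
        have lim: "(\<lambda>N. \<Sum>k=1..N. C j k * x k) \<longlonglongrightarrow> matrix_apply C x j" if "1 \<le> j" for j
        proof -
          have "((\<lambda>k. C j k * x k) has_sum matrix_apply C x j) {1..}"
            using assms x that unfolding l2_operator_def matrix_apply_def by simp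
          then have "(sum (\<lambda>k. C j k * x k) \<longlongrightarrow> matrix_apply C x j) (finite_subsets_at_top {1..})"
            by (simp add: has_sum_def)
          \<comment> \<open>Initial segments are cofinal among the finite index sets, so the
            unordered sum is also the limit of its ordered partial sums.\<close>
          moreover have "filterlim (\<lambda>N. {1..N}) (finite_subsets_at_top {1::nat..}) sequentially"
            unfolding filterlim_finite_subsets_at_top
          proof (intro allI impI)
            fix F :: "nat set" assume F: "finite F \<and> F \<subseteq> {1..}"
            show "\<forall>\<^sub>F N in sequentially. finite {1..N} \<and> F \<subseteq> {1..N} \<and> {1..N} \<subseteq> {1..}"
              using eventually_ge_at_top[of "Max (insert 0 F)"] by eventually_elim (use F in auto)
          qed
          ultimately show ?thesis by (rule filterlim_compose)
        qed
        have "(\<lambda>N. L2_set (\<lambda>j. cmod (\<Sum>k=1..N. C j k * x k)) {1..M}) \<longlonglongrightarrow>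
            L2_set (\<lambda>j. cmod (matrix_apply C x j)) {1..M}"
          unfolding L2_set_def by (intro tendsto_intros lim) auto
        then show "L2_set (\<lambda>j. cmod (matrix_apply C x j)) {1..M} \<le> K * r"
          by (rule LIMSEQ_le_const2) (use partial in auto)
      qed
      then show ?thesis using r real(1) by (simp add: ennreal_mult)
    qed
    then show ?thesis
      unfolding operator_norm_def real(2) by (intro Inf_lower) auto
  qed simp
qed

section \<open>The form on all series\<close>

text \<open>For g = 1 the form is the functional that pairs f with the symbol, whose norm is that of
  the symbol. Truncation keeps the test functions polynomial and covers symbols of infinite norm.
  The test function 1 is not in \<open>H2_0\<close>.\<close>

lemma l2_norm_le_hankel_norm: "l2_norm \<phi> \<le> hankel_norm H2 \<phi>"
  unfolding hankel_norm_def
proof (rule Inf_greatest, elim CollectE)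
  fix K' assume K': "\<forall>f\<in>H2. \<forall>g\<in>H2. dirichlet_polynomial f \<longrightarrow> dirichlet_polynomial g \<longrightarrow>
    ennreal (cmod (hankel_form \<phi> f g)) \<le> K' * l2_norm f * l2_norm g"
  show "l2_norm \<phi> \<le> K'"
  proof (cases K')
    case (real K)
    show ?thesis unfolding real(2)
    proof (rule l2_norm_leI)
      fix N
      define f where "f n = (if n \<in> {1..N} then \<phi> n else 0)" for n
      define g :: dirichlet_series where "g n = (if n = 1 then 1 else 0)" for n
      define A where "A = L2_set (\<lambda>n. cmod (\<phi> n)) {1..N}"
      have fg: "dirichlet_polynomial f" "dirichlet_polynomial g"
        by (auto simp: dirichlet_polynomial_def f_def g_def)
      have f: "l2_norm f = ennreal A"
        unfolding A_def
        by (subst l2_norm_finite_support[of "{1..N}"]) (auto simp: f_def intro!: L2_set_cong)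
      have g: "l2_norm g = 1"
        by (subst l2_norm_finite_support[of "{1}"]) (auto simp: g_def)
      have mult: "dirichlet_mult f g n = f n" if "1 \<le> n" for n
      proof -
        \<comment> \<open>The factor \<open>g (n div d)\<close> vanishes unless
          \<open>d = n\<close>.\<close>
        have "dirichlet_mult f g n = (\<Sum>d\<in>{n}. f d * g (n div d))"
          unfolding dirichlet_mult_def
          by (rule sum.mono_neutral_right) (use that in \<open>auto simp: g_def\<close>)
        then show ?thesis using that by (simp add: g_def)
      qed
      have "hankel_form \<phi> f g = (\<Sum>\<^sub>\<infinity>n\<in>{1..N}. \<phi> n * cnj (\<phi> n))"
        unfolding hankel_form_def H2_inner_def
        by (rule infsum_cong_neutral) (auto simp: mult, auto simp: f_def)
      also have "\<dots> = complex_of_real (A\<^sup>2)"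
        by (simp add: A_def L2_set_def sum_nonneg complex_mult_cnj cmod_power2)
      finally have "cmod (hankel_form \<phi> f g) = A\<^sup>2" by (simp del: of_real_power)
      moreover have "ennreal (cmod (hankel_form \<phi> f g)) \<le> ennreal K * l2_norm f * l2_norm g"
        using K' fg real by (simp add: H2_def dirichlet_polynomial_in_l2)
      moreover have "0 \<le> A" by (simp add: A_def)
      ultimately have "A * A \<le> A * K"
        using real(1) by (simp add: f g ennreal_mult[symmetric] ennreal_le_iff power2_eq_square mult_ac)
      then show "L2_set (\<lambda>n. cmod (\<phi> n)) {1..N} \<le> K"
        unfolding A_def[symmetric] using \<open>0 \<le> A\<close> real(1)
        by (cases "A = 0") (auto simp: mult_le_cancel_left)
    qed
  qed simp
qed

lemma hankel_norm_le_l2_norm: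
  "hankel_norm H2 (matrix_series C) \<le> ennreal 4 * l2_norm (matrix_series C)"
proof (cases "matrix_series C \<in> l2")
  case False
  then have "l2_norm (matrix_series C) = \<infinity>" by (simp add: l2_def less_top[symmetric])
  then show ?thesis by (simp add: ennreal_mult_top)
next
  case True
  obtain h where h: "0 \<le> h" "l2_norm (matrix_series C) = ennreal h"
    "\<And>F. finite F \<Longrightarrow> F \<subseteq> {1..} \<Longrightarrow> L2_set (\<lambda>n. cmod (matrix_series C n)) F \<le> h"
    using l2_norm_real[OF True] by metis
  have "hankel_norm H2 (matrix_series C) \<le> ennreal (4 * h)"
  proof (rule hankel_norm_leI)
    fix f g assume fg: "dirichlet_polynomial f" "dirichlet_polynomial g"
    obtain N where form: "hankel_form (matrix_series C) f g =
        (\<Sum>j=1..N. \<Sum>k=1..N. (f 1 * g (odd_prime j * even_prime k) + f (odd_prime j) * g (even_prime k)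
        + f (even_prime k) * g (odd_prime j) + f (odd_prime j * even_prime k) * g 1) * cnj (C j k))"
      using hankel_form_matrix_series[OF fg, of C] by (meson order_refl)
    let ?T = "{1..N} \<times> {1..N}"
    let ?pq = "\<lambda>(j, k). odd_prime j * even_prime k"
    have inj: "inj_on ?pq ?T" by (rule inj_on_subset[OF inj_on_odd_even_product]) auto
    have pq: "finite (?pq ` ?T)" "?pq ` ?T \<subseteq> {1..}"
      by (auto simp: Suc_le_eq odd_prime_pos even_prime_pos odd_prime_pos[THEN gr_implies_not0] even_prime_pos[THEN gr_implies_not0])
    obtain r where r: "0 \<le> r" "l2_norm f = ennreal r"
      "\<And>F. finite F \<Longrightarrow> F \<subseteq> {1..} \<Longrightarrow> L2_set (\<lambda>n. cmod (f n)) F \<le> r"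
      using l2_norm_real[OF dirichlet_polynomial_in_l2[OF fg(1)]] by metis
    obtain s where s: "0 \<le> s" "l2_norm g = ennreal s"
      "\<And>F. finite F \<Longrightarrow> F \<subseteq> {1..} \<Longrightarrow> L2_set (\<lambda>n. cmod (g n)) F \<le> s"
      using l2_norm_real[OF dirichlet_polynomial_in_l2[OF fg(2)]] by metis
    have f1: "cmod (f 1) \<le> r" and g1: "cmod (g 1) \<le> s"
      using r(3)[of "{1}"] s(3)[of "{1}"] by auto
    have injp: "inj_on odd_prime {1..N}" "inj_on even_prime {1..N}"
      by (auto intro: inj_on_subset[OF inj_on_odd_prime] inj_on_subset[OF inj_on_even_prime])
    have primes: "odd_prime ` {1..N} \<subseteq> {1..}" "even_prime ` {1..N} \<subseteq> {1..}"
      using odd_prime_ge_one even_prime_ge_one by auto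
    have f_primes: "L2_set (\<lambda>j. cmod (f (odd_prime j))) {1..N} \<le> r"
      "L2_set (\<lambda>j. cmod (f (even_prime j))) {1..N} \<le> r"
      using r(3)[OF _ primes(1)] r(3)[OF _ primes(2)]
      unfolding L2_set_reindex[OF injp(1)] L2_set_reindex[OF injp(2)] by auto
    have g_primes: "L2_set (\<lambda>j. cmod (g (odd_prime j))) {1..N} \<le> s"
      "L2_set (\<lambda>j. cmod (g (even_prime j))) {1..N} \<le> s"
      using s(3)[OF _ primes(1)] s(3)[OF _ primes(2)]
      unfolding L2_set_reindex[OF injp(1)] L2_set_reindex[OF injp(2)] by auto
    \<comment> \<open>One majorant per divisor of pq. \<open>t1\<close> and \<open>t4\<close>
      combine a value at 1 with a restriction to the products pq, while \<open>t2\<close> and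
      \<open>t3\<close> are rank-one arrays; each has norm at most \<open>r * s\<close>.\<close>
    define t1 where "t1 i = cmod (f 1) * cmod (g (?pq i))" for i
    define t2 where "t2 = (\<lambda>(j, k). cmod (f (odd_prime j)) * cmod (g (even_prime k)))"
    define t3 where "t3 = (\<lambda>(j, k). cmod (g (odd_prime j)) * cmod (f (even_prime k)))"
    define t4 where "t4 i = cmod (f (?pq i)) * cmod (g 1)" for i
    have "L2_set t1 ?T = cmod (f 1) * L2_set (\<lambda>n. cmod (g n)) (?pq ` ?T)"
      unfolding L2_set_reindex[OF inj] t1_def[abs_def] by (simp add: L2_set_right_distrib)
    also have "\<dots> \<le> r * s" using f1 s(3)[OF pq] r(1) by (intro mult_mono) auto
    finally have t1: "L2_set t1 ?T \<le> r * s" .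
    have t2: "L2_set t2 ?T \<le> r * s"
      unfolding t2_def L2_set_product using f_primes g_primes r(1) by (intro mult_mono) auto
    have t3: "L2_set t3 ?T \<le> s * r"
      unfolding t3_def L2_set_product using f_primes g_primes s(1) by (intro mult_mono) auto
    have "L2_set t4 ?T = L2_set (\<lambda>n. cmod (f n)) (?pq ` ?T) * cmod (g 1)"
      unfolding L2_set_reindex[OF inj] t4_def[abs_def] by (simp add: L2_set_left_distrib)
    also have "\<dots> \<le> r * s" using g1 r(3)[OF pq] r(1) by (intro mult_mono) auto
    finally have t4: "L2_set t4 ?T \<le> r * s" .
    define e where "e = (\<lambda>(j, k). f 1 * g (odd_prime j * even_prime k) + f (odd_prime j) * g (even_prime k)
        + f (even_prime k) * g (odd_prime j) + f (odd_prime j * even_prime k) * g 1)"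
    have "cmod (e i) \<le> t1 i + t2 i + t3 i + t4 i" for i
      unfolding e_def t1_def t2_def t3_def t4_def case_prod_unfold
      by (intro order_trans[OF norm_triangle_ineq] add_mono) (simp_all add: norm_mult mult.commute)
    then have "L2_set (\<lambda>i. cmod (e i)) ?T \<le> L2_set (\<lambda>i. t1 i + t2 i + t3 i + t4 i) ?T"
      by (intro L2_set_mono) auto
    also have "\<dots> \<le> L2_set t1 ?T + L2_set t2 ?T + L2_set t3 ?T + L2_set t4 ?T"
      by (intro order_trans[OF L2_set_triangle_ineq] add_mono order_refl)
    also have "\<dots> \<le> 4 * (r * s)" using t1 t2 t3 t4 by (simp add: mult.commute)
    finally have e: "L2_set (\<lambda>i. cmod (e i)) ?T \<le> 4 * (r * s)" .
    have "L2_set (\<lambda>i. cmod (case i of (j, k) \<Rightarrow> cnj (C j k))) ?T =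
        L2_set (\<lambda>i. cmod (matrix_series C (?pq i))) ?T"
      by (intro L2_set_cong) (auto simp: matrix_series_product)
    also have "\<dots> \<le> h" using h(3)[OF pq] unfolding L2_set_reindex[OF inj] .
    finally have C: "L2_set (\<lambda>i. cmod (case i of (j, k) \<Rightarrow> cnj (C j k))) ?T \<le> h" .
    \<comment> \<open>The matrix stays a single factor, so Cauchy--Schwarz over all pairs brings in
      its Hilbert--Schmidt norm once.\<close>
    have "hankel_form (matrix_series C) f g = (\<Sum>i\<in>?T. e i * (case i of (j, k) \<Rightarrow> cnj (C j k)))"
      unfolding form sum.cartesian_product e_def by (intro sum.cong) auto
    also have "cmod \<dots> \<le> L2_set (\<lambda>i. cmod (e i)) ?T *
        L2_set (\<lambda>i. cmod (case i of (j, k) \<Rightarrow> cnj (C j k))) ?T"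
      by (rule norm_sum_mult_le_L2_set)
    also have "\<dots> \<le> 4 * (r * s) * h" using e C r(1) s(1) by (intro mult_mono) auto
    finally have "cmod (hankel_form (matrix_series C) f g) \<le> 4 * h * r * s" by (simp add: mult_ac)
    then show "ennreal (cmod (hankel_form (matrix_series C) f g)) \<le> ennreal (4 * h) * l2_norm f * l2_norm g"
      unfolding r(2) s(2) using r(1) s(1) h(1) by (simp add: ennreal_mult[symmetric] ennreal_leI)
  qed
  then show ?thesis using h by (simp add: ennreal_mult)
qed

theorem theorem1:
  shows "(\<forall>C. l2_operator C \<longrightarrow> hankel_norm H2_0 (matrix_series C) = operator_norm C) \<and>
    (\<exists>c1 c2 :: real. 0 < c1 \<and> 0 < c2 \<and>
      (\<forall>C. l2_operator C \<longrightarrow>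
        ennreal c1 * hilbert_schmidt_norm C \<le> hankel_norm H2 (matrix_series C) \<and>
        hankel_norm H2 (matrix_series C) \<le> ennreal c2 * hilbert_schmidt_norm C \<and>
        hilbert_schmidt_norm C = l2_norm (matrix_series C)))"
proof (rule conjI)
  show "\<forall>C. l2_operator C \<longrightarrow> hankel_norm H2_0 (matrix_series C) = operator_norm C"
    using hankel_norm_le_operator_norm operator_norm_le_hankel_norm by (blast intro: antisym)
  \<comment> \<open>The constant 1 comes from testing with g = 1, and 4 counts the divisors of
    pq.\<close>
  have "ennreal 1 * hilbert_schmidt_norm C \<le> hankel_norm H2 (matrix_series C) \<and>
      hankel_norm H2 (matrix_series C) \<le> ennreal 4 * hilbert_schmidt_norm C \<and>
      hilbert_schmidt_norm C = l2_norm (matrix_series C)" for C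
    using l2_norm_le_hankel_norm hankel_norm_le_l2_norm
    by (simp add: hilbert_schmidt_norm_eq_l2_norm)
  moreover have "(0::real) < 1" "(0::real) < 4" by simp_all
  ultimately show "\<exists>c1 c2 :: real. 0 < c1 \<and> 0 < c2 \<and>
      (\<forall>C. l2_operator C \<longrightarrow>
        ennreal c1 * hilbert_schmidt_norm C \<le> hankel_norm H2 (matrix_series C) \<and>
        hankel_norm H2 (matrix_series C) \<le> ennreal c2 * hilbert_schmidt_norm C \<and>
        hilbert_schmidt_norm C = l2_norm (matrix_series C))"
    by blast
qed

end
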